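(* Suppose the stabilisation forms vanish for constant test functions, i.e. $s_h^n(u_h,1)=0$ for all $u_h\in V_h^n$ and all $n=1,\dots,N$. Let $u_h^n\in V_h^n$, $n=1,\dots,N$, solve, with given initial value $u_h^0$, $$\frac{1}{\Delta t}\left[\int_{\Omega_h^n}u_h^n v_h\,dx-\int_{\Omega_h^{n-1}}u_h^{n-1}v_h\,dx\right]+a_h^n(u_h^n,v_h)+\nu s_h^n(u_h^n,v_h)=f_h^n(v_h)\qquad\text{for all }v_h\in V_h^n .$$ Then the scheme is conservative: for every $n\in\{1,\dots,N\}$, $$\int_{\Omega_h^n}u_h^n\,dx=\int_{\Omega_h^0}u_h^0\,dx+\Delta t\sum_{k=1}^n\int_{\Omega_h^k}f^k\,dx .$$
   Context: Let $d\in\{2,3\}$, $T>0$, $\nu>0$, $\Delta t=T/N$, $t_n=n\Delta t$. $\widetilde\Omega\subset\mathbb{R}^d$ is a fixed background domain with a quasi-uniform simplicial mesh $\mathcal{T}_h$ of mesh size $h$. For each $n$, $\Omega_h^n\subset\widetilde\Omega$ is a discrete approximation of the physical domain $\Omega(t_n)$. For $\delta_h>0$ the active mesh $\mathcal{T}_h^n$ is the set of elements $K\in\mathcal{T}_h$ containing a point $x$ with $\mathrm{dist}(x,\Omega_h^n)\le\delta_h$, and the active domain is $\widetilde\Omega_h^n=\bigcup_{K\in\mathcal{T}_h^n}\overline K$. The parameter $\delta_h$ (proportional to $\Delta t$) is chosen such that $\Omega_h^{n-1}\subset\widetilde\Omega_h^n$. For $k\ge1$, $V_h^n$ is the space of continuous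 functions on $\widetilde\Omega_h^n$ that are polynomials of degree at most $k$ on each $K\in\mathcal{T}_h^n$. With the transport field $\mathbf{w}^n=\mathbf{w}(t_n)$ and source $f^n=f(t_n)$, $$a_h^n(u,v)=\int_{\Omega_h^n}\nu\nabla u\cdot\nabla v-u(\mathbf{w}^n\cdot\nabla v)\,dx,\qquad f_h^n(v)=\int_{\Omega_h^n}f^n v\,dx ,$$ and $s_h^n(\cdot,\cdot)$ is a stabilisation bilinear form on $V_h^n$. *)

theory Defs
  imports "HOL-Analysis.Analysis"
begin

text \<open>
  An element may be open, closed, or contain only part of its boundary: only its closure is
  required to be a simplex.  The closures form a conforming triangulation of the closure of the
  background domain, \<open>h\<close> is the largest element diameter, and quasi-uniformity with constant
  \<open>\<rho>\<close> means that every element contains a ball of radius \<open>\<rho> * h\<close>.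
\<close>

definition quasi_uniform_simplicial_mesh ::
    "('a::euclidean_space) set \<Rightarrow> 'a set set \<Rightarrow> real \<Rightarrow> real \<Rightarrow> bool" where
  "quasi_uniform_simplicial_mesh D \<T> h \<rho> \<longleftrightarrow>
     (\<forall>K\<in>\<T>. \<exists>S. int DIM('a) simplex S \<and> interior S \<subseteq> K \<and> K \<subseteq> S) \<and>
     inj_on closure \<T> \<and>
     triangulation (closure ` \<T>) \<and>
     (\<Union>K\<in>\<T>. closure K) = closure D \<and>
     h = Max (diameter ` \<T>) \<and>
     0 < \<rho> \<and>
     (\<forall>K\<in>\<T>. \<exists>x. ball x (\<rho> * h) \<subseteq> K)"

text \<open>
  In the following two definitions \<open>\<Omega>\<close> should be nonempty, since \<open>infdist x {} = 0\<close>.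
\<close>

definition active_mesh :: "('a::euclidean_space) set set \<Rightarrow> real \<Rightarrow> 'a set \<Rightarrow> 'a set set" where
  "active_mesh \<T> \<delta> \<Omega> = {K \<in> \<T>. \<exists>x\<in>K. infdist x \<Omega> \<le> \<delta>}"

definition active_domain :: "('a::euclidean_space) set set \<Rightarrow> real \<Rightarrow> 'a set \<Rightarrow> 'a set" where
  "active_domain \<T> \<delta> \<Omega> = (\<Union>K\<in>active_mesh \<T> \<delta> \<Omega>. closure K)"

definition polynomial_deg_le :: "nat \<Rightarrow> (real ^ 'd \<Rightarrow> real) \<Rightarrow> bool" where
  "polynomial_deg_le k p \<longleftrightarrow>
     (\<exists>c :: ('d \<Rightarrow> nat) \<Rightarrow> real. \<forall>x.
        p x = (\<Sum>\<alpha> | (\<Sum>i\<in>UNIV. \<alpha> i) \<le> k. c \<alpha> * (\<Prod>i\<in>UNIV. (x $ i) ^ \<alpha> i)))"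

text \<open>
  A function on the active domain is represented by its extension by zero, so that distinct
  elements of \<open>fe_space\<close> are distinct functions on the active domain.  In particular the
  constant function 1 is represented by the indicator function of the active domain.
\<close>

definition fe_space ::
    "nat \<Rightarrow> (real ^ 'd) set set \<Rightarrow> real \<Rightarrow> (real ^ 'd) set \<Rightarrow> (real ^ 'd \<Rightarrow> real) set" where
  "fe_space k \<T> \<delta> \<Omega> =
     {v. continuous_on (active_domain \<T> \<delta> \<Omega>) v \<and>
         (\<forall>K\<in>active_mesh \<T> \<delta> \<Omega>. \<exists>p. polynomial_deg_le k p \<and> (\<forall>x\<in>K. v x = p x)) \<and>
         (\<forall>x. x \<notin> active_domain \<T> \<delta> \<Omega> \<longrightarrow> v x = 0)}"

definition fe_one :: "(real ^ 'd) set set \<Rightarrow> real \<Rightarrow> (real ^ 'd) set \<Rightarrow> real ^ 'd \<Rightarrow> real" where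
  "fe_one \<T> \<delta> \<Omega> = indicat_real (active_domain \<T> \<delta> \<Omega>)"

definition bilinear_form_on ::
    "('a \<Rightarrow> real) set \<Rightarrow> (('a \<Rightarrow> real) \<Rightarrow> ('a \<Rightarrow> real) \<Rightarrow> real) \<Rightarrow> bool" where
  "bilinear_form_on V s \<longleftrightarrow>
     (\<forall>u\<in>V. \<forall>v\<in>V. \<forall>w\<in>V. \<forall>c.
        s (\<lambda>x. u x + v x) w = s u w + s v w \<and>
        s (\<lambda>x. c * u x) w = c * s u w \<and>
        s w (\<lambda>x. u x + v x) = s w u + s w v \<and>
        s w (\<lambda>x. c * u x) = c * s w u)"

text \<open>
  For \<open>u\<close> in \<open>fe_space\<close> the pointwise gradient exists in the interior of every active element,
  that is, almost everywhere in the active domain, and is the elementwise gradient there.  Where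
  \<open>u\<close> is not differentiable its value is arbitrary.
\<close>

definition grad :: "(real ^ 'd \<Rightarrow> real) \<Rightarrow> real ^ 'd \<Rightarrow> real ^ 'd" where
  "grad u x = (\<chi> i. frechet_derivative u (at x) (axis i 1))"

definition a_form ::
    "real \<Rightarrow> (real ^ 'd \<Rightarrow> real ^ 'd) \<Rightarrow> (real ^ 'd) set \<Rightarrow>
     (real ^ 'd \<Rightarrow> real) \<Rightarrow> (real ^ 'd \<Rightarrow> real) \<Rightarrow> real" where
  "a_form \<nu> w \<Omega> u v =
     (LINT x:\<Omega>|lebesgue. \<nu> * (grad u x \<bullet> grad v x) - u x * (w x \<bullet> grad v x))"

definition load_form ::
    "(real ^ 'd \<Rightarrow> real) \<Rightarrow> (real ^ 'd) set \<Rightarrow> (real ^ 'd \<Rightarrow> real) \<Rightarrow> real" where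
  "load_form f \<Omega> v = (LINT x:\<Omega>|lebesgue. f x * v x)"

end

theory Submission
  imports Defs
begin

text \<open>
  The indicator of the active domain is an admissible test function.  A point of \<open>\<Omega>\<close> lies in the
  interior of the active domain, because \<open>\<delta> > 0\<close> and \<open>\<Omega>\<close> is contained in the open background
  domain; hence the gradient of this test function vanishes everywhere on \<open>\<Omega>\<close> and so does the
  form \<open>a\<close>.  What remains of the scheme is a telescoping identity for the total mass.
\<close>

text \<open>Over an infinite index set the sum in \<open>polynomial_deg_le\<close> would be 0 by
  convention; finiteness lets \<open>sum.delta\<close> extract a single coefficient from it.\<close>

lemma finite_multi_indices_le:
  "finite {\<alpha> :: 'd::finite \<Rightarrow> nat. (\<Sum>i\<in>UNIV. \<alpha> i) \<le> k}"
proof (rule finite_subset)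
  show "{\<alpha> :: 'd \<Rightarrow> nat. (\<Sum>i\<in>UNIV. \<alpha> i) \<le> k} \<subseteq> PiE UNIV (\<lambda>_. {..k})"
  proof
    fix \<alpha> :: "'d \<Rightarrow> nat" assume \<alpha>: "\<alpha> \<in> {\<alpha>. (\<Sum>i\<in>UNIV. \<alpha> i) \<le> k}"
    have "\<alpha> i \<le> k" for i
    proof -
      have "\<alpha> i \<le> (\<Sum>i\<in>UNIV. \<alpha> i)" by (rule member_le_sum) simp_all
      with \<alpha> show ?thesis by simp
    qed
    then show "\<alpha> \<in> PiE UNIV (\<lambda>_. {..k})" by (simp add: PiE_iff)
  qed
qed (simp add: finite_PiE)

lemma polynomial_deg_le_const: "polynomial_deg_le k (\<lambda>x :: real ^ 'd. a)"
  unfolding polynomial_deg_le_def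
proof (intro exI allI)
  fix x :: "real ^ 'd"
  let ?S = "{\<alpha> :: 'd \<Rightarrow> nat. (\<Sum>i\<in>UNIV. \<alpha> i) \<le> k}"
  \<comment> \<open>The coefficient family is supported at the zero multi-index. Its monomial is 1
    at every point, also where a coordinate vanishes, since 0^0 = 1.\<close>
  have "(\<Sum>\<alpha>\<in>?S. (if \<alpha> = (\<lambda>_. 0) then a else 0) * (\<Prod>i\<in>UNIV. (x $ i) ^ \<alpha> i))
      = (\<Sum>\<alpha>\<in>?S. if \<alpha> = (\<lambda>_. 0) then a else 0)"
    by (intro sum.cong) auto
  also have "\<dots> = a"
    by (simp add: sum.delta finite_multi_indices_le)
  finally show "a = (\<Sum>\<alpha>\<in>?S. (if \<alpha> = (\<lambda>_. 0) then a else 0) * (\<Prod>i\<in>UNIV. (x $ i) ^ \<alpha> i))"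
    by simp
qed

text \<open>Continuity is required only relative to the active domain, so the jump of the indicator
  across its boundary does no harm.\<close>

lemma fe_one_in_fe_space: "fe_one \<T> \<delta> \<Omega> \<in> fe_space k \<T> \<delta> \<Omega>"
proof -
  have "continuous_on (active_domain \<T> \<delta> \<Omega>) (fe_one \<T> \<delta> \<Omega>)"
    by (rule continuous_on_eq[OF continuous_on_const[of _ 1]]) (simp add: fe_one_def)
  moreover have "fe_one \<T> \<delta> \<Omega> x = 1" if "K \<in> active_mesh \<T> \<delta> \<Omega>" "x \<in> K" for K x
  proof -
    have "x \<in> active_domain \<T> \<delta> \<Omega>"
      using that closure_subset by (auto simp: active_domain_def)
    then show ?thesis by (simp add: fe_one_def)
  qed
  moreover have "fe_one \<T> \<delta> \<Omega> x = 0" if "x \<notin> active_domain \<T> \<delta> \<Omega>" for x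
    using that by (simp add: fe_one_def)
  ultimately show ?thesis
    using polynomial_deg_le_const[of k 1] unfolding fe_space_def by blast
qed

text \<open>The interior matters because \<open>grad\<close> at a point sees a full neighbourhood of
  it. Such a neighbourhood is the part of \<open>D\<close> within distance \<delta>/2 of the
  point.\<close>

lemma subset_interior_active_domain:
  assumes "open D" "\<Omega> \<subseteq> D" "D \<subseteq> (\<Union>K\<in>\<T>. closure K)" "\<delta> > 0"
  shows "\<Omega> \<subseteq> interior (active_domain \<T> \<delta> \<Omega>)"
proof
  fix x assume x: "x \<in> \<Omega>"
  have "D \<inter> ball x (\<delta>/2) \<subseteq> active_domain \<T> \<delta> \<Omega>"
  proof
    fix y assume y: "y \<in> D \<inter> ball x (\<delta>/2)"
    then obtain K where K: "K \<in> \<T>" "y \<in> closure K" using assms(3) by blast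
    \<comment> \<open>Activity of \<open>K\<close> is tested on points of \<open>K\<close> itself,
      while \<open>y\<close> lies only in its closure. One half of \<delta> pays for moving from
      \<open>y\<close> to \<open>z\<close>, the other for the distance from \<open>y\<close> to
      \<open>x\<close>.\<close>
    then obtain z where z: "z \<in> K" "dist z y < \<delta>/2"
      using \<open>\<delta> > 0\<close> by (meson closure_approachable half_gt_zero)
    have "infdist z \<Omega> \<le> dist z x" by (rule infdist_le[OF x])
    also have "\<dots> \<le> dist z y + dist x y" by (rule dist_triangle2)
    also have "\<dots> \<le> \<delta>" using z y by (simp add: mem_ball)
    finally show "y \<in> active_domain \<T> \<delta> \<Omega>"
      using K z unfolding active_domain_def active_mesh_def by blast
  qed
  moreover have "open (D \<inter> ball x (\<delta>/2))" "x \<in> D \<inter> ball x (\<delta>/2)"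
    using assms x by auto
  ultimately show "x \<in> interior (active_domain \<T> \<delta> \<Omega>)"
    by (meson interiorI)
qed

text \<open>Near an interior point the indicator coincides with the constant 1, so its derivative
  exists there and \<open>grad\<close> is not an arbitrary value.\<close>

lemma grad_fe_one:
  assumes "x \<in> interior (active_domain \<T> \<delta> \<Omega>)"
  shows "grad (fe_one \<T> \<delta> \<Omega>) x = 0"
proof -
  have "(fe_one \<T> \<delta> \<Omega> has_derivative (\<lambda>_. 0)) (at x)"
    using has_derivative_const[of 1] open_interior assms
  proof (rule has_derivative_transform_within_open)
    show "1 = fe_one \<T> \<delta> \<Omega> y" if "y \<in> interior (active_domain \<T> \<delta> \<Omega>)" for y
      using that interior_subset by (force simp: fe_one_def)
  qed
  then have "frechet_derivative (fe_one \<T> \<delta> \<Omega>) (at x) = (\<lambda>_. 0)"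
    by (simp add: frechet_derivative_at[symmetric])
  then show ?thesis by (simp add: grad_def vec_eq_iff)
qed

text \<open>Both the diffusive and the convective term carry the gradient of the test function as a
  factor, so the integrand vanishes pointwise on \<open>A\<close>.\<close>

lemma a_form_fe_one:
  assumes "A \<in> sets lebesgue" "A \<subseteq> interior (active_domain \<T> \<delta> \<Omega>)"
  shows "a_form \<nu> w A z (fe_one \<T> \<delta> \<Omega>) = 0"
proof -
  have "a_form \<nu> w A z (fe_one \<T> \<delta> \<Omega>) = (LINT x:A|lebesgue. 0)"
    unfolding a_form_def using assms
    by (intro set_lebesgue_integral_cong) (auto simp: grad_fe_one subset_iff)
  then show ?thesis by (simp add: set_lebesgue_integral_def)
qed

text \<open>\<open>A\<close> is kept separate from \<Omega> because the test function of one time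
  level is integrated over both the new and the previous domain.\<close>

lemma set_lebesgue_integral_times_fe_one:
  assumes "A \<in> sets lebesgue" "A \<subseteq> active_domain \<T> \<delta> \<Omega>"
  shows "(LINT x:A|lebesgue. g x * fe_one \<T> \<delta> \<Omega> x) = (LINT x:A|lebesgue. g x)"
  using assms by (intro set_lebesgue_integral_cong) (auto simp: fe_one_def subset_iff)

theorem mainTheorem3:
  fixes T \<nu> \<Delta>t h \<rho> \<delta>\<^sub>h :: real
    and N k :: nat
    and t :: "nat \<Rightarrow> real"
    and D :: "(real ^ 'd) set"
    and \<T> :: "(real ^ 'd) set set"
    and \<Omega>\<^sub>h :: "nat \<Rightarrow> (real ^ 'd) set"
    and w :: "real \<Rightarrow> real ^ 'd \<Rightarrow> real ^ 'd"
    and f :: "real \<Rightarrow> real ^ 'd \<Rightarrow> real"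
    and s :: "nat \<Rightarrow> (real ^ 'd \<Rightarrow> real) \<Rightarrow> (real ^ 'd \<Rightarrow> real) \<Rightarrow> real"
    and u :: "nat \<Rightarrow> real ^ 'd \<Rightarrow> real"
  defines "\<Delta>t \<equiv> T / real N"
    and "t \<equiv> \<lambda>n. real n * \<Delta>t"
  assumes "CARD('d) \<in> {2, 3}"
    and "T > 0" and "\<nu> > 0" and "N \<ge> 1" and "k \<ge> 1"
    and "open D" and "connected D" and "D \<noteq> {}"
    and "quasi_uniform_simplicial_mesh D \<T> h \<rho>"
    and "\<forall>n\<in>{0..N}. \<Omega>\<^sub>h n \<noteq> {} \<and> \<Omega>\<^sub>h n \<in> sets lebesgue \<and> \<Omega>\<^sub>h n \<subseteq> D"
    and "\<delta>\<^sub>h > 0"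
    and "\<forall>n\<in>{1..N}. \<Omega>\<^sub>h (n - 1) \<subseteq> active_domain \<T> \<delta>\<^sub>h (\<Omega>\<^sub>h n)"
    and "\<forall>n\<in>{1..N}. set_integrable lebesgue (\<Omega>\<^sub>h n) (w (t n))"
    and "\<forall>n\<in>{1..N}. set_integrable lebesgue (\<Omega>\<^sub>h n) (f (t n))"
    and "\<forall>n\<in>{1..N}. bilinear_form_on (fe_space k \<T> \<delta>\<^sub>h (\<Omega>\<^sub>h n)) (s n)"
    and "\<forall>n\<in>{1..N}. \<forall>z\<in>fe_space k \<T> \<delta>\<^sub>h (\<Omega>\<^sub>h n). s n z (fe_one \<T> \<delta>\<^sub>h (\<Omega>\<^sub>h n)) = 0"
    and "set_integrable lebesgue (\<Omega>\<^sub>h 0) (u 0)"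
    and "\<forall>n\<in>{1..N}. u n \<in> fe_space k \<T> \<delta>\<^sub>h (\<Omega>\<^sub>h n)"
    and "\<forall>n\<in>{1..N}. \<forall>v\<in>fe_space k \<T> \<delta>\<^sub>h (\<Omega>\<^sub>h n).
           1 / \<Delta>t * ((LINT x:\<Omega>\<^sub>h n|lebesgue. u n x * v x)
                      - (LINT x:\<Omega>\<^sub>h (n - 1)|lebesgue. u (n - 1) x * v x))
           + a_form \<nu> (w (t n)) (\<Omega>\<^sub>h n) (u n) v + \<nu> * s n (u n) v
           = load_form (f (t n)) (\<Omega>\<^sub>h n) v"
  shows "\<forall>n\<in>{1..N}.
           (LINT x:\<Omega>\<^sub>h n|lebesgue. u n x)
           = (LINT x:\<Omega>\<^sub>h 0|lebesgue. u 0 x)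
             + \<Delta>t * (\<Sum>j=1..n. LINT x:\<Omega>\<^sub>h j|lebesgue. f (t j) x)"
proof -
  let ?I = "\<lambda>n. LINT x:\<Omega>\<^sub>h n|lebesgue. u n x"
  let ?F = "\<lambda>n. LINT x:\<Omega>\<^sub>h n|lebesgue. f (t n) x"
  have "\<Delta>t > 0" using \<open>T > 0\<close> \<open>N \<ge> 1\<close> by (simp add: \<Delta>t_def)
  have "D \<subseteq> (\<Union>K\<in>\<T>. closure K)"
    using \<open>quasi_uniform_simplicial_mesh D \<T> h \<rho>\<close> closure_subset
    by (auto simp: quasi_uniform_simplicial_mesh_def)
  have step: "?I n = ?I (n - 1) + \<Delta>t * ?F n" if n: "n \<in> {1..N}" for n
  proof -
    let ?v = "fe_one \<T> \<delta>\<^sub>h (\<Omega>\<^sub>h n)"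
    have meas: "\<Omega>\<^sub>h n \<in> sets lebesgue" "\<Omega>\<^sub>h (n - 1) \<in> sets lebesgue" and "\<Omega>\<^sub>h n \<subseteq> D"
      using assms(12) n by auto
    then have int: "\<Omega>\<^sub>h n \<subseteq> interior (active_domain \<T> \<delta>\<^sub>h (\<Omega>\<^sub>h n))"
      using subset_interior_active_domain \<open>open D\<close> \<open>D \<subseteq> (\<Union>K\<in>\<T>. closure K)\<close> \<open>\<delta>\<^sub>h > 0\<close>
      by blast
    then have sub: "\<Omega>\<^sub>h n \<subseteq> active_domain \<T> \<delta>\<^sub>h (\<Omega>\<^sub>h n)"
      using interior_subset by blast
    \<comment> \<open>This inclusion makes the new test function equal to 1 on the whole old domain,
      so that none of the old mass is lost in the time step.\<close>
    have prev: "\<Omega>\<^sub>h (n - 1) \<subseteq> active_domain \<T> \<delta>\<^sub>h (\<Omega>\<^sub>h n)"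
      using assms(14) n by blast
    have stab: "s n (u n) ?v = 0"
      using assms(18,20) n by blast
    have "1 / \<Delta>t * ((LINT x:\<Omega>\<^sub>h n|lebesgue. u n x * ?v x)
                      - (LINT x:\<Omega>\<^sub>h (n - 1)|lebesgue. u (n - 1) x * ?v x))
           + a_form \<nu> (w (t n)) (\<Omega>\<^sub>h n) (u n) ?v + \<nu> * s n (u n) ?v
           = load_form (f (t n)) (\<Omega>\<^sub>h n) ?v"
      using assms(21) n fe_one_in_fe_space by blast
    then have "1 / \<Delta>t * (?I n - ?I (n - 1)) = ?F n"
      by (simp add: load_form_def set_lebesgue_integral_times_fe_one a_form_fe_one
          meas int sub prev stab del: One_nat_def)
    then show ?thesis
      using \<open>\<Delta>t > 0\<close> by (simp add: field_simps)
  qed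
  \<comment> \<open>Including n = 0, where the source sum is empty, lets the induction start from
    the initial mass.\<close>
  have total: "?I n = ?I 0 + \<Delta>t * (\<Sum>j=1..n. ?F j)" if "n \<le> N" for n
    using that
  proof (induction n)
    case (Suc n)
    then show ?case using step[of "Suc n"] by (simp add: distrib_left)
  qed simp
  show ?thesis
  proof
    fix n assume "n \<in> {1..N}"
    then have "n \<le> N" by simp
    then show "?I n = ?I 0 + \<Delta>t * (\<Sum>j=1..n. ?F j)" by (rule total)
  qed
qed

end
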